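(* Let $D\equiv 2,3\pmod 4$ be a squarefree positive integer with $\sqrt D=[u_0,\overline{u_1,\dots,u_{s-1},2u_0}]$. Let $i\ge -1$ be odd and let $r_0$ be an integer with $0\le r_0\le u_{i+2}$ such that $N(\alpha_{i,r_0})$ is maximal among the values $N(\alpha_{i,r})$ for integers $0\le r\le u_{i+2}$. Then $$\frac{u_{i+2}}2-1<r_0<\frac{u_{i+2}}2+1.$$ If $u_{i+2}$ is even, then $r_0=\frac{u_{i+2}}2$.
   Context: Here $u_j$ ($j\ge 0$) are the partial quotients of the continued fraction of $\sqrt D$, so $u_{sk}=2u_0$ and $u_{sk+j}=u_j$ for $k>0$, $1\le j\le s-1$. Put $p_{-1}=1$, $p_0=u_0$, $q_{-1}=0$, $q_0=1$, $p_{i+1}=u_{i+1}p_i+p_{i-1}$, $q_{i+1}=u_{i+1}q_i+q_{i-1}$ for $i\ge0$. Define $\alpha_i=p_i+q_i\sqrt D\in\mathbb Z[\sqrt D]$ for $i\ge -1$ and the semiconvergents $\alpha_{i,r}=\alpha_i+r\alpha_{i+1}$ for $i\ge -1$ and $0\le r\le u_{i+2}$. The norm is $N(x+y\sqrt D)=x^2-Dy^2$. *)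

theory Defs
  imports Complex_Main "HOL-Computational_Algebra.Squarefree"
begin

fun complete_quotient :: "real \<Rightarrow> nat \<Rightarrow> real" where
  "complete_quotient x 0 = x"
| "complete_quotient x (Suc n) = 1 / (complete_quotient x n - of_int \<lfloor>complete_quotient x n\<rfloor>)"

(* For irrational x no complete quotient is an integer, so the division by zero
   convention is never used; for rational x the values past the end of the
   finite expansion are meaningless. *)
definition partial_quotient :: "real \<Rightarrow> nat \<Rightarrow> int" where
  "partial_quotient x n = \<lfloor>complete_quotient x n\<rfloor>"

(* Numerators and denominators are indexed by integers i >= -1, as is customary;
   the values at i < -1 are irrelevant. *)
function conv_num :: "(nat \<Rightarrow> int) \<Rightarrow> int \<Rightarrow> int" where
  "conv_num u i =
     (if i \<le> -1 then 1 else if i = 0 then u 0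
      else u (nat i) * conv_num u (i - 1) + conv_num u (i - 2))"
  by pat_completeness auto
termination by (relation "measure (\<lambda>(u, i). nat (i + 2))") auto

function conv_den :: "(nat \<Rightarrow> int) \<Rightarrow> int \<Rightarrow> int" where
  "conv_den u i =
     (if i \<le> -1 then 0 else if i = 0 then 1
      else u (nat i) * conv_den u (i - 1) + conv_den u (i - 2))"
  by pat_completeness auto
termination by (relation "measure (\<lambda>(u, i). nat (i + 2))") auto

(* The unconditional recursive equations would loop as simplification rules. *)
declare conv_num.simps [simp del] conv_den.simps [simp del]

lemma conv_initial:
  "conv_num u (-1) = 1" "conv_num u 0 = u 0"
  "conv_den u (-1) = 0" "conv_den u 0 = 1"
  by (simp_all add: conv_num.simps conv_den.simps)

lemma conv_rec:
  assumes "i \<ge> 0"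
  shows "conv_num u (i + 1) = u (nat (i + 1)) * conv_num u i + conv_num u (i - 1)"
    and "conv_den u (i + 1) = u (nat (i + 1)) * conv_den u i + conv_den u (i - 1)"
  using assms by (subst conv_num.simps conv_den.simps; simp)+

definition quad_conv :: "nat \<Rightarrow> (nat \<Rightarrow> int) \<Rightarrow> int \<Rightarrow> real" where
  "quad_conv D u i = of_int (conv_num u i) + of_int (conv_den u i) * sqrt (real D)"

definition semiconv :: "nat \<Rightarrow> (nat \<Rightarrow> int) \<Rightarrow> int \<Rightarrow> int \<Rightarrow> real" where
  "semiconv D u i r = quad_conv D u i + of_int r * quad_conv D u (i + 1)"

(* The norm on Z[sqrt D], viewed as a subring of the reals. The description is
   unique whenever sqrt D is irrational, see quad_norm_eq. *)
definition quad_norm :: "nat \<Rightarrow> real \<Rightarrow> int" where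
  "quad_norm D z =
     (THE n. \<exists>x y :: int. z = of_int x + of_int y * sqrt (real D) \<and> n = x\<^sup>2 - int D * y\<^sup>2)"

lemma quad_norm_eq:
  fixes x y :: int
  assumes irr: "sqrt (real D) \<notin> \<rat>"
  shows "quad_norm D (of_int x + of_int y * sqrt (real D)) = x\<^sup>2 - int D * y\<^sup>2"
proof -
  have uniq: "a = x \<and> b = y"
    if eq: "of_int x + of_int y * sqrt (real D) = of_int a + of_int b * sqrt (real D)"
    for a b :: int
  proof -
    have *: "of_int (y - b) * sqrt (real D) = of_int (a - x)"
      using eq by (simp add: algebra_simps)
    have "b = y"
    proof (rule ccontr)
      assume "b \<noteq> y"
      hence "sqrt (real D) = of_int (a - x) / of_int (y - b)"
        using * by (simp add: field_simps)
      with irr show False by (metis Rats_divide Rats_of_int)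
    qed
    with eq show ?thesis by simp
  qed
  show ?thesis
    unfolding quad_norm_def by (rule the_equality) (use uniq in blast)+
qed

end

theory Submission
  imports Defs
begin

text \<open>
  Write \<open>\<alpha>\<close> and \<open>e\<close> for a convergent \<open>p + q * sqrt D\<close> and its conjugate \<open>p - q * sqrt D\<close>, and let
  \<open>x\<close> be the complete quotient with index \<open>i + 2\<close>. The recursion of the continued fraction gives
  \<open>e\<^sub>i = - x * e\<^sub>i\<^sub>+\<^sub>1\<close>, so the norm of a semiconvergent splits as
  \<open>N (\<alpha>\<^sub>i + r * \<alpha>\<^sub>i\<^sub>+\<^sub>1) = - N (\<alpha>\<^sub>i\<^sub>+\<^sub>1) * (\<rho> + r) * (x - r)\<close> with \<open>\<rho> = \<alpha>\<^sub>i / \<alpha>\<^sub>i\<^sub>+\<^sub>1\<close>.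

  The errors \<open>e\<close> alternate in sign, so for odd \<open>i\<close> this is a downward parabola in \<open>r\<close>. One root is
  \<open>- \<rho>\<close>, which lies in \<open>(-1, 0)\<close> because the \<open>\<alpha>\<close> are positive and increasing; the other is \<open>x\<close>,
  which lies in \<open>[u, u + 1)\<close> for the partial quotient \<open>u\<close> with index \<open>i + 2\<close>. The vertex is
  therefore at distance less than \<open>1/2\<close> from \<open>u / 2\<close>. An integer maximiser is within \<open>1/2\<close> of the
  vertex, hence within distance less than \<open>1\<close> of \<open>u / 2\<close>; if \<open>u / 2\<close> is itself an integer, the two
  coincide.
\<close>

section \<open>Complete quotients of irrational numbers\<close>

lemma sqrt_squarefree_irrational:
  fixes D :: nat
  assumes "squarefree D" and "D \<noteq> 1"
  shows "sqrt (real D) \<notin> \<rat>"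
proof
  assume "sqrt (real D) \<in> \<rat>"
  then obtain m n :: nat
    where n: "n \<noteq> 0" and eq: "\<bar>sqrt (real D)\<bar> = real m / real n" and cop: "coprime m n"
    by (rule Rats_abs_nat_div_natE)
  have "real D * (real n)\<^sup>2 = (\<bar>sqrt (real D)\<bar> * real n)\<^sup>2"
    by (simp add: power_mult_distrib)
  also have "\<dots> = (real m)\<^sup>2"
    using n by (simp add: eq)
  finally have sq: "D * n\<^sup>2 = m\<^sup>2"
    by (metis of_nat_eq_iff of_nat_mult of_nat_power)
  have "n\<^sup>2 dvd m\<^sup>2"
    using sq by (metis dvd_triv_right)
  with cop have "n = 1"
    by (simp add: coprime_absorb_right)
  with sq have "m\<^sup>2 dvd D"
    by simp
  with assms(1) have "m dvd 1"
    by (rule squarefreeD)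
  with \<open>n = 1\<close> sq assms(2) show False
    by simp
qed

lemma complete_quotient_irrational:
  assumes "x \<notin> \<rat>"
  shows "complete_quotient x n \<notin> \<rat>"
proof (induction n)
  case (Suc n)
  show ?case
  proof
    assume "complete_quotient x (Suc n) \<in> \<rat>"
    then have "1 / complete_quotient x (Suc n) + of_int \<lfloor>complete_quotient x n\<rfloor> \<in> \<rat>"
      by (intro Rats_add Rats_divide) auto
    with Suc.IH show False
      by simp
  qed
qed (use assms in simp)

lemma complete_quotient_minus_partial_quotient:
  assumes "x \<notin> \<rat>"
  shows "0 < complete_quotient x n - of_int (partial_quotient x n)"
    and "complete_quotient x n - of_int (partial_quotient x n) < 1"
proof -
  have "complete_quotient x n \<noteq> of_int \<lfloor>complete_quotient x n\<rfloor>"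
    using complete_quotient_irrational[OF assms, of n] by (metis Rats_of_int)
  then show "0 < complete_quotient x n - of_int (partial_quotient x n)"
    unfolding partial_quotient_def by linarith
  show "complete_quotient x n - of_int (partial_quotient x n) < 1"
    unfolding partial_quotient_def by linarith
qed

lemma complete_quotient_Suc_gt_1:
  assumes "x \<notin> \<rat>"
  shows "1 < complete_quotient x (Suc n)"
  using complete_quotient_minus_partial_quotient[OF assms, of n]
  by (simp add: partial_quotient_def)

section \<open>Approximation errors of convergents\<close>

text \<open>
  This is the identity \<open>x = (x\<^sub>n\<^sub>+\<^sub>1 * p\<^sub>n + p\<^sub>n\<^sub>-\<^sub>1) / (x\<^sub>n\<^sub>+\<^sub>1 * q\<^sub>n + q\<^sub>n\<^sub>-\<^sub>1)\<close> in terms of approximation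
  errors: multiplying an error by minus the next complete quotient undoes one step of the recursion.
\<close>

lemma convergent_error_step:
  fixes x :: real
  defines "u \<equiv> partial_quotient x"
  defines "e \<equiv> \<lambda>i. of_int (conv_num u i) - of_int (conv_den u i) * x"
  assumes irr: "x \<notin> \<rat>"
  shows "e (int n - 1) = - complete_quotient x (Suc n) * e (int n)"
proof (induction n)
  case 0
  show ?case
    using complete_quotient_minus_partial_quotient[OF irr, of 0]
    by (simp add: e_def u_def conv_initial partial_quotient_def field_simps)
next
  case (Suc n)
  define d where "d = complete_quotient x (Suc n) - of_int (u (Suc n))"
  have "e (int n + 1) = of_int (u (Suc n)) * e (int n) + e (int n - 1)"
    using conv_rec[of "int n" u] by (simp add: e_def nat_add_distrib algebra_simps)
  also have "\<dots> = - d * e (int n)"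
    by (simp add: d_def Suc.IH algebra_simps del: complete_quotient.simps)
  finally have "e (int n + 1) = - d * e (int n)" .
  moreover have "complete_quotient x (Suc (Suc n)) = 1 / d"
    by (simp add: d_def u_def partial_quotient_def)
  moreover have "d \<noteq> 0"
    using complete_quotient_minus_partial_quotient(1)[OF irr, of "Suc n"] by (simp add: d_def u_def)
  ultimately have "- complete_quotient x (Suc (Suc n)) * e (int n + 1) = e (int n)"
    by (simp only:) simp
  then show ?case
    by (simp add: add.commute del: complete_quotient.simps)
qed

text \<open>
  Complete quotients after the first exceed 1, so the factor \<open>- x\<^sub>n\<^sub>+\<^sub>1\<close> between consecutive errors is
  negative.
\<close>

lemma convergent_error_sign:
  fixes x :: real
  defines "u \<equiv> partial_quotient x"
  assumes irr: "x \<notin> \<rat>"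
  shows "0 < (-1) ^ Suc n * (of_int (conv_num u (int n)) - of_int (conv_den u (int n)) * x)"
proof (induction n)
  case 0
  show ?case
    using complete_quotient_minus_partial_quotient(1)[OF irr, of 0]
    by (simp add: u_def conv_initial)
next
  case (Suc n)
  let ?c = "complete_quotient x (Suc (Suc n))"
  have "0 < ?c"
    using complete_quotient_Suc_gt_1[OF irr, of "Suc n"] by linarith
  have "0 < ?c * ((-1) ^ Suc (Suc n) *
      (of_int (conv_num u (int (Suc n))) - of_int (conv_den u (int (Suc n))) * x))"
    using Suc.IH convergent_error_step[OF irr, of "Suc n"]
    by (simp add: u_def mult_ac del: complete_quotient.simps)
  with \<open>0 < ?c\<close> show ?case
    by (simp only: zero_less_mult_pos)
qed

section \<open>Norms of semiconvergents\<close>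

lemma quad_conv_strict_increasing:
  assumes u: "u = partial_quotient (sqrt (real D))"
    and irr: "sqrt (real D) \<notin> \<rat>" and "D > 0"
  shows "0 < quad_conv D u (int n - 1) \<and> quad_conv D u (int n - 1) < quad_conv D u (int n)"
proof (induction n)
  case 0
  have "1 \<le> sqrt (real D)"
    using \<open>D > 0\<close> by simp
  moreover from this have "1 \<le> u 0"
    by (simp add: u partial_quotient_def)
  then have "1 \<le> real_of_int (u 0)"
    by simp
  ultimately have "1 < real_of_int (u 0) + sqrt (real D)"
    by linarith
  then show ?case
    by (simp add: quad_conv_def conv_initial)
next
  case (Suc n)
  have "1 \<le> u (Suc n)"
    using complete_quotient_Suc_gt_1[OF irr, of n]
    by (simp add: u partial_quotient_def del: complete_quotient.simps)
  then have "1 * quad_conv D u (int n) \<le> of_int (u (Suc n)) * quad_conv D u (int n)"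
    using Suc.IH by (intro mult_right_mono) auto
  moreover have "quad_conv D u (int n + 1) =
      of_int (u (Suc n)) * quad_conv D u (int n) + quad_conv D u (int n - 1)"
    using conv_rec[of "int n" u] by (simp add: quad_conv_def nat_add_distrib algebra_simps)
  ultimately have "quad_conv D u (int n) < quad_conv D u (int n + 1)"
    using Suc.IH by linarith
  with Suc.IH show ?case
    by (simp add: add.commute)
qed

lemma quad_norm_eq_mult_conjugate:
  fixes a b :: int
  assumes "sqrt (real D) \<notin> \<rat>"
  shows "of_int (quad_norm D (of_int a + of_int b * sqrt (real D))) =
    (of_int a + of_int b * sqrt (real D)) * (of_int a - of_int b * sqrt (real D))"
  unfolding quad_norm_eq[OF assms] by (simp add: algebra_simps power2_eq_square)

text \<open>
  The norm is the product of \<open>\<alpha>\<^sub>i + r * \<alpha>\<^sub>i\<^sub>+\<^sub>1\<close> and its conjugate \<open>e\<^sub>i + r * e\<^sub>i\<^sub>+\<^sub>1\<close>. The ratio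
  \<open>e\<^sub>i / e\<^sub>i\<^sub>+\<^sub>1\<close> is minus a complete quotient, which makes both roots in \<open>r\<close> explicit.
\<close>

lemma quad_norm_semiconv_factor:
  fixes D n :: nat and r :: int
  defines "u \<equiv> partial_quotient (sqrt (real D))"
  defines "\<alpha> \<equiv> quad_conv D u"
  assumes irr: "sqrt (real D) \<notin> \<rat>" and "D > 0"
  shows "of_int (quad_norm D (semiconv D u (int n - 1) r)) =
    - of_int (quad_norm D (\<alpha> (int n))) * (\<alpha> (int n - 1) / \<alpha> (int n) + of_int r) *
      (complete_quotient (sqrt (real D)) (Suc n) - of_int r)"
proof -
  let ?w = "sqrt (real D)" and ?i = "int n - 1" and ?j = "int n"
  define e where "e i = of_int (conv_num u i) - of_int (conv_den u i) * ?w" for i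
  note norm = quad_norm_eq_mult_conjugate[OF irr]
  have "semiconv D u ?i r = of_int (conv_num u ?i + r * conv_num u ?j)
      + of_int (conv_den u ?i + r * conv_den u ?j) * ?w"
    by (simp add: semiconv_def quad_conv_def algebra_simps)
  then have "of_int (quad_norm D (semiconv D u ?i r)) =
      (\<alpha> ?i + of_int r * \<alpha> ?j) * (e ?i + of_int r * e ?j)"
    by (simp only: norm) (simp add: \<alpha>_def e_def quad_conv_def algebra_simps)
  moreover have "e ?i = - complete_quotient ?w (Suc n) * e ?j"
    using convergent_error_step[OF irr, of n] by (simp only: e_def u_def)
  moreover have "\<alpha> ?i = \<alpha> ?i / \<alpha> ?j * \<alpha> ?j"
    using quad_conv_strict_increasing[OF u_def[THEN meta_eq_to_obj_eq] irr \<open>D > 0\<close>, of n]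
    by (simp add: \<alpha>_def)
  ultimately have "of_int (quad_norm D (semiconv D u ?i r)) =
      (\<alpha> ?i / \<alpha> ?j * \<alpha> ?j + of_int r * \<alpha> ?j) *
      (- complete_quotient ?w (Suc n) * e ?j + of_int r * e ?j)"
    by metis
  also have "\<dots> = - (\<alpha> ?j * e ?j) * (\<alpha> ?i / \<alpha> ?j + of_int r) *
      (complete_quotient ?w (Suc n) - of_int r)"
    by algebra
  also have "\<alpha> ?j * e ?j = of_int (quad_norm D (\<alpha> ?j))"
    by (simp only: \<alpha>_def e_def quad_conv_def norm)
  finally show ?thesis .
qed

lemma quad_norm_convergent_neg:
  fixes D n :: nat
  defines "u \<equiv> partial_quotient (sqrt (real D))"
  assumes irr: "sqrt (real D) \<notin> \<rat>" and "D > 0" and "even n"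
  shows "quad_norm D (quad_conv D u (int n)) < 0"
proof -
  let ?w = "sqrt (real D)"
  have "0 < quad_conv D u (int n)"
    using quad_conv_strict_increasing[OF u_def[THEN meta_eq_to_obj_eq] irr \<open>D > 0\<close>, of n] by linarith
  moreover have "of_int (conv_num u (int n)) - of_int (conv_den u (int n)) * ?w < 0"
    using convergent_error_sign[OF irr, of n] \<open>even n\<close> by (simp add: u_def)
  ultimately have "quad_conv D u (int n) *
      (of_int (conv_num u (int n)) - of_int (conv_den u (int n)) * ?w) < 0"
    by (rule mult_pos_neg)
  moreover have "of_int (quad_norm D (quad_conv D u (int n))) = quad_conv D u (int n) *
      (of_int (conv_num u (int n)) - of_int (conv_den u (int n)) * ?w)"
    by (simp only: quad_conv_def quad_norm_eq_mult_conjugate[OF irr])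
  ultimately show ?thesis
    by (simp only: flip: of_int_less_0_iff[where 'a = real])
qed

section \<open>Integer maximisers\<close>

text \<open>
  Stepping from \<open>r\<close> to \<open>r + 1\<close> changes the product by a positive multiple of \<open>x - \<rho> - 2 * r - 1\<close>,
  so comparing a maximiser with its two neighbours bounds it on both sides. At an end of the range,
  where one neighbour is absent, the missing bound is trivial.
\<close>

lemma parabola_integer_maximiser_near_midpoint:
  fixes A \<rho> x :: real and m r\<^sub>0 :: int
  assumes "0 < A" and "0 < \<rho>" "\<rho> < 1" and "of_int m \<le> x" "x < of_int m + 1"
    and "0 \<le> r\<^sub>0" "r\<^sub>0 \<le> m"
    and max: "\<And>r. 0 \<le> r \<Longrightarrow> r \<le> m \<Longrightarrow>
      A * (\<rho> + of_int r) * (x - of_int r) \<le> A * (\<rho> + of_int r\<^sub>0) * (x - of_int r\<^sub>0)"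
  shows "\<bar>2 * r\<^sub>0 - m\<bar> < 2"
proof -
  have step: "A * (\<rho> + of_int (r + 1)) * (x - of_int (r + 1)) - A * (\<rho> + of_int r) * (x - of_int r)
      = A * (x - \<rho> - 2 * of_int r - 1)" for r :: int
    by (simp add: algebra_simps)
  have "2 * r\<^sub>0 < m + 2"
  proof (cases "r\<^sub>0 = 0")
    case False
    then have "0 \<le> A * (x - \<rho> - 2 * of_int (r\<^sub>0 - 1) - 1)"
      using max[of "r\<^sub>0 - 1"] step[of "r\<^sub>0 - 1"] assms(6,7) by simp
    then have "0 \<le> x - \<rho> - 2 * of_int (r\<^sub>0 - 1) - 1"
      using \<open>0 < A\<close> by (simp add: zero_le_mult_iff)
    then have "2 * real_of_int r\<^sub>0 < of_int m + 2"
      using assms(2,5) by simp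
    then show ?thesis
      by linarith
  qed (use assms(6,7) in simp)
  moreover have "m - 2 < 2 * r\<^sub>0"
  proof (cases "r\<^sub>0 = m")
    case False
    then have "A * (x - \<rho> - 2 * of_int r\<^sub>0 - 1) \<le> 0"
      using max[of "r\<^sub>0 + 1"] step[of "r\<^sub>0"] assms(6,7) by simp
    then have "x - \<rho> - 2 * of_int r\<^sub>0 - 1 \<le> 0"
      using \<open>0 < A\<close> by (simp add: mult_le_0_iff)
    then have "real_of_int m - 2 < 2 * of_int r\<^sub>0"
      using assms(3,4) by simp
    then show ?thesis
      by linarith
  qed (use assms(6,7) in simp)
  ultimately show ?thesis
    by linarith
qed

theorem proposition10:
  fixes D s :: nat and u :: "nat \<Rightarrow> int" and i r\<^sub>0 :: int
  assumes "D > 0" and "squarefree D" and "D mod 4 = 2 \<or> D mod 4 = 3"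
    and "\<And>j. u j = partial_quotient (sqrt (real D)) j"
    and "s \<ge> 1"
    and "\<And>k. k > 0 \<Longrightarrow> u (s * k) = 2 * u 0"
    and "\<And>k j. k > 0 \<Longrightarrow> 1 \<le> j \<Longrightarrow> j \<le> s - 1 \<Longrightarrow> u (s * k + j) = u j"
    and "i \<ge> -1" and "odd i"
    and "0 \<le> r\<^sub>0" and "r\<^sub>0 \<le> u (nat (i + 2))"
    and "\<And>r :: int. 0 \<le> r \<Longrightarrow> r \<le> u (nat (i + 2)) \<Longrightarrow>
           quad_norm D (semiconv D u i r) \<le> quad_norm D (semiconv D u i r\<^sub>0)"
  shows "real_of_int (u (nat (i + 2))) / 2 - 1 < real_of_int r\<^sub>0 \<and>
         real_of_int r\<^sub>0 < real_of_int (u (nat (i + 2))) / 2 + 1 \<and>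
         (even (u (nat (i + 2))) \<longrightarrow> real_of_int r\<^sub>0 = real_of_int (u (nat (i + 2))) / 2)"
proof -
  let ?w = "sqrt (real D)"
  have u: "u = partial_quotient ?w"
    using assms(4) by auto
  have "D \<noteq> 1"
    using assms(3) by auto
  with assms(2) have irr: "?w \<notin> \<rat>"
    by (rule sqrt_squarefree_irrational)
  obtain n where n: "i = int n - 1"
    using assms(8) by (intro that[of "nat (i + 1)"]) simp
  with assms(9) have "even n"
    by simp
  define m where "m = u (Suc n)"
  have m: "u (nat (i + 2)) = m"
    by (simp add: n m_def nat_add_distrib)
  define A where "A = - real_of_int (quad_norm D (quad_conv D u (int n)))"
  define \<rho> where "\<rho> = quad_conv D u (int n - 1) / quad_conv D u (int n)"
  define x where "x = complete_quotient ?w (Suc n)"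
  have factor: "of_int (quad_norm D (semiconv D u i r)) = A * (\<rho> + of_int r) * (x - of_int r)" for r
    using quad_norm_semiconv_factor[OF irr assms(1), of n r] by (simp only: u n A_def \<rho>_def x_def)
  have "\<bar>2 * r\<^sub>0 - m\<bar> < 2"
  proof (rule parabola_integer_maximiser_near_midpoint)
    show "0 < A"
      using quad_norm_convergent_neg[OF irr assms(1) \<open>even n\<close>] by (simp add: A_def u)
    show "0 < \<rho>" "\<rho> < 1"
      using quad_conv_strict_increasing[OF u irr assms(1), of n] by (simp_all add: \<rho>_def)
    show "of_int m \<le> x" "x < of_int m + 1"
      by (simp_all add: m_def x_def u partial_quotient_def del: complete_quotient.simps)
    show "0 \<le> r\<^sub>0" "r\<^sub>0 \<le> m"
      using assms(10,11) by (simp_all add: m)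
    show "A * (\<rho> + of_int r) * (x - of_int r) \<le> A * (\<rho> + of_int r\<^sub>0) * (x - of_int r\<^sub>0)"
      if "0 \<le> r" "r \<le> m" for r
      using assms(12)[of r] that by (simp only: m flip: factor) simp
  qed
  then have "m < 2 * r\<^sub>0 + 2" "2 * r\<^sub>0 < m + 2" "even m \<longrightarrow> 2 * r\<^sub>0 = m"
    by presburger+
  then show ?thesis
    unfolding m by auto
qed

end
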